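(* Let $m\ge2$, $n\ge1$, $K\in C(\mathbb R^n)$, $\bar{\mathbf q}\in\mathbb R^n$, $\bar{\mathcal A}=(\bar a_{i_1\ldots i_m})\in\mathcal T_{m,n}$, and let $\bar{\mathbf x}\in{\rm SOL}(K,\bar{\mathbf q},\bar{\mathcal A})$. Suppose that $\bar{\mathcal A}$ is sub-symmetric with respect to the indices $\{i_2,\ldots,i_m\}$ and that $$\sum_{i_1,\ldots,i_m=1}^n\bar a_{i_1i_2i_3\ldots i_m}v_{i_1}v_{i_2}\bar x_{i_3}\cdots\bar x_{i_m}>0\qquad\text{for all nonzero }\mathbf v\in\mathscr T(\bar{\mathbf x},K)\cap\mathbb S(\bar{\mathbf x}),$$ where $\mathbb S(\bar{\mathbf x})=\{\mathbf v\in\mathbb R^n:\ \mathbf v^\top(\bar{\mathcal A}\bar{\mathbf x}^{m-1}+\bar{\mathbf q})=0\}$. Then for every open neighborhood $\mathcal N$ of $\bar{\mathbf x}$ satisfying ${\rm SOL}(K,\bar{\mathbf q},\bar{\mathcal A})\cap{\rm cl}(\mathcal N)=\{\bar{\mathbf x}\}$, there exists a scalar $c>0$ such that, for all vectors $\mathbf q\in\mathbb R^n$ and all tensors $\mathcal A\in\mathcal T_{m,n}$, $$\sup\{\|\mathbf x-\bar{\mathbf x}\|:\ \mathbf x\in{\rm SOL}(K,\mathbf q,\mathcal A)\cap{\rm cl}(\mathcal N)\}\le c\,(\|\mathbf q-\bar{\mathbf q}\|+\|\mathcal A-\bar{\mathcal A}\|_F).$$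
   Context: $C(\mathbb R^n)$ is the set of nonzero closed convex cones in $\mathbb R^n$. $\mathcal T_{m,n}$ is the space of real $m$-th order $n$-dimensional tensors $\mathcal A=(a_{i_1\ldots i_m})_{1\le i_1,\ldots,i_m\le n}$ with $\|\mathcal A\|_F=(\sum a_{i_1\ldots i_m}^2)^{1/2}$. For $\mathbf x\in\mathbb R^n$, $\mathcal A\mathbf x^{m-1}\in\mathbb R^n$ has components $(\mathcal A\mathbf x^{m-1})_i=\sum_{i_2,\ldots,i_m=1}^n a_{ii_2\ldots i_m}x_{i_2}\cdots x_{i_m}$. For $K\in C(\mathbb R^n)$, $K^*=\{\mathbf y\in\mathbb R^n:\langle\mathbf y,\mathbf x\rangle\ge0\ \forall \mathbf x\in K\}$ and $${\rm SOL}(K,\mathbf q,\mathcal A)=\{\mathbf x\in K:\ \mathcal A\mathbf x^{m-1}+\mathbf q\in K^*,\ \langle\mathbf x,\mathcal A\mathbf x^{m-1}+\mathbf q\rangle=0\}.$$ $\mathcal A$ is sub-symmetric with respect to $\{i_2,\ldots,i_m\}$ if for every $i$ the $(m-1)$-th order tensor $(a_{ii_2\ldots i_m})_{1\le i_2,\ldots,i_m\le n}$ is symmetric (its entries are invariant under permutations of $i_2,\ldots,i_m$). The tangent cone $\mathscr T(\bar{\mathbf x},K)$ of $K$ at $\bar{\mathbf x}\in K$ consists of all $\mathbf v\in\mathbb R^n$ for which there exist $\mathbf x^{(k)}\in K$ and $\tau_k>0$ with $\mathbf x^{(k)}\to\bar{\mathbf x}$, $\tau_k\to0$ and $(\mathbf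 x^{(k)}-\bar{\mathbf x})/\tau_k\to\mathbf v$. ${\rm cl}$ denotes topological closure. When $m=2$ the product $\bar x_{i_3}\cdots\bar x_{i_m}$ is the empty product $1$. A supremum over the empty set is read so that the inequality holds trivially.
   Formalization: The neighborhood N is assumed bounded. Without this the claim is false: for m=2, n=1, K=ℝ, q̄=0, Ā=1, x̄=0, N=ℝ all hypotheses hold, but q=0, A=0 has every real number as a solution, so the supremum is infinite. *)

theory Defs
  imports "HOL-Analysis.Analysis"
begin

definition cones :: "(real ^ 'n) set set" where
  "cones = {K. closed K \<and> convex K \<and> cone K \<and> K \<noteq> {} \<and> K \<noteq> {0}}"

(* R^n is real ^ 'n.  The order m of a tensor has to remain a number (indices are split off below),
   so the entry with indices (i_1, ..., i_m) is the value of A at the list [i_1, ..., i_m].  Values at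
   lists of any other length are set to 0, so that two tensors are equal iff their entries agree. *)
type_synonym 'n tensor = "'n list \<Rightarrow> real"

definition tensors :: "nat \<Rightarrow> ('n::finite) tensor set" where
  "tensors m = {A. \<forall>is. length is \<noteq> m \<longrightarrow> A is = 0}"

definition frob_norm :: "nat \<Rightarrow> ('n::finite) tensor \<Rightarrow> real" where
  "frob_norm m A = sqrt (\<Sum>is | length is = m. (A is)\<^sup>2)"

(* The product of the x_j over the index list js; it is 1 for the empty list. *)
definition monom_at :: "real ^ 'n \<Rightarrow> 'n list \<Rightarrow> real" where
  "monom_at x js = prod_list (map (\<lambda>j. x $ j) js)"

(* The vector written A x^(m-1); meant for m >= 1. *)
definition tensor_app :: "nat \<Rightarrow> 'n tensor \<Rightarrow> real ^ 'n \<Rightarrow> real ^ ('n::finite)" where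
  "tensor_app m A x = (\<chi> i. \<Sum>js | length js = m - 1. A (i # js) * monom_at x js)"

definition dual_cone :: "(real ^ 'n) set \<Rightarrow> (real ^ ('n::finite)) set" where
  "dual_cone K = {y. \<forall>x\<in>K. y \<bullet> x \<ge> 0}"

definition SOL :: "nat \<Rightarrow> (real ^ 'n) set \<Rightarrow> real ^ 'n \<Rightarrow> 'n tensor \<Rightarrow> (real ^ ('n::finite)) set" where
  "SOL m K q A =
     {x \<in> K. tensor_app m A x + q \<in> dual_cone K \<and> x \<bullet> (tensor_app m A x + q) = 0}"

(* Equality of multisets says that one index list is a permutation of the other. *)
definition symmetric_tensor :: "nat \<Rightarrow> 'n tensor \<Rightarrow> bool" where
  "symmetric_tensor k B \<longleftrightarrow>
     (\<forall>js js'. length js = k \<and> length js' = k \<and> mset js = mset js' \<longrightarrow> B js = B js')"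

definition sub_symmetric :: "nat \<Rightarrow> 'n tensor \<Rightarrow> bool" where
  "sub_symmetric m A \<longleftrightarrow> (\<forall>i. symmetric_tensor (m - 1) (\<lambda>js. A (i # js)))"

definition tangent_cone :: "real ^ 'n \<Rightarrow> (real ^ 'n) set \<Rightarrow> (real ^ ('n::finite)) set" where
  "tangent_cone xbar K =
     {v. \<exists>(x :: nat \<Rightarrow> real ^ 'n) (\<tau> :: nat \<Rightarrow> real).
           (\<forall>k. x k \<in> K) \<and> (\<forall>k. \<tau> k > 0) \<and> x \<longlonglongrightarrow> xbar \<and> \<tau> \<longlonglongrightarrow> 0 \<and>
           (\<lambda>k. (x k - xbar) /\<^sub>R \<tau> k) \<longlonglongrightarrow> v}"

definition critical_hyperplane ::
  "nat \<Rightarrow> real ^ 'n \<Rightarrow> 'n tensor \<Rightarrow> real ^ 'n \<Rightarrow> (real ^ ('n::finite)) set" where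
  "critical_hyperplane m q A x = {v. v \<bullet> (tensor_app m A x + q) = 0}"

(* The error bound over SOL m K q A Int closure N, for all q and A, needs N to be bounded: for m = 2,
   n = 1, K = R, qbar = 0, xbar = 0, Abar = 1 and N = R all the other hypotheses hold, but q = 0 and
   A = 0 are at finite distance from the data while every real number solves the problem. *)

end

theory Submission
  imports Defs
begin

text \<open>
  Write \<open>F x = tensor_app m Abar x + qbar\<close>. The idea is to regard a solution \<open>x\<close> of a perturbed
  problem as an approximate solution of the unperturbed one: the vector
  \<open>w = tensor_app m A x + q\<close> lies in the dual cone, is orthogonal to \<open>x\<close>, and differs from
  \<open>F x\<close> only by \<open>tensor_app m (A - Abar) x + (q - qbar)\<close>. Since the tensor application is
  bounded by the Frobenius norm (lemma \<open>norm_tensor_app_le\<close>) and \<open>x\<close> ranges over a bounded set,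
  this residual is at most a constant times the perturbation of the data. It remains to bound the
  distance from \<open>x\<close> to \<open>xbar\<close> by the residual, which lemma
  \<open>complementarity_residual_bound\<close> does for any continuous \<open>F\<close> that is differentiable at \<open>xbar\<close>.

  The residual bound is proved by contradiction. If it fails, there are points \<open>x k\<close> whose residuals
  are \<open>o(norm (x k - xbar))\<close>. By compactness they accumulate at a solution, which can only be
  \<open>xbar\<close>, and the normalised differences \<open>(x k - xbar) / norm (x k - xbar)\<close> accumulate at a unit
  tangent vector \<open>v\<close>. Pairing \<open>xbar\<close> and \<open>x k\<close> with the two complementarity conditions gives
  \<open>(x k - xbar) \<bullet> F xbar \<ge> 0\<close> and \<open>(x k - xbar) \<bullet> w k \<le> 0\<close>. Divided by the distance, these give
  \<open>v \<bullet> F xbar = 0\<close> in the limit; subtracted and divided by its square, they give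
  \<open>v \<bullet> L v \<le> 0\<close> for the derivative \<open>L\<close> of \<open>F\<close> at \<open>xbar\<close>.

  Finally, sub-symmetry identifies \<open>v \<bullet> L v\<close> with \<open>m - 1\<close> times the form in the hypothesis
  (lemma \<open>inner_deriv_tensor_app\<close>), which is positive at every nonzero critical tangent vector.
\<close>

section \<open>Sums over index lists and the norm of a tensor application\<close>

lemma finite_lists_length [simp]: "finite {is :: 'a::finite list. length is = k}"
  using finite_lists_length_eq[of "UNIV :: 'a set" k] by simp

lemma sum_lists_length_Suc:
  fixes f :: "'a::finite list \<Rightarrow> real"
  shows "(\<Sum>is | length is = Suc k. f is) = (\<Sum>i\<in>UNIV. \<Sum>js | length js = k. f (i # js))"
proof -
  have "(\<Sum>is | length is = Suc k. f is)
      = (\<Sum>(i, js)\<in>UNIV \<times> {js. length js = k}. f (i # js))"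
    by (rule sum.reindex_bij_witness[of _ "\<lambda>(i, js). i # js" "\<lambda>is. (hd is, tl is)"])
       (auto simp: length_Suc_conv)
  then show ?thesis
    by (simp add: sum.cartesian_product)
qed

lemma monom_at_Nil [simp]: "monom_at x [] = 1"
  by (simp add: monom_at_def)

lemma monom_at_Cons [simp]: "monom_at x (j # js) = x $ j * monom_at x js"
  by (simp add: monom_at_def)

text \<open>
  The monomials of length \<open>k\<close> are the entries of the \<open>k\<close>-fold tensor power of \<open>x\<close>, whose Frobenius
  norm is multiplicative.
\<close>

lemma sum_monom_at_squares:
  fixes x :: "real ^ 'n::finite"
  shows "(\<Sum>js | length js = k. (monom_at x js)\<^sup>2) = (norm x ^ k)\<^sup>2"
proof (induction k)
  case 0
  then show ?case by simp
next
  case (Suc k)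
  have "(\<Sum>i\<in>UNIV. (x $ i)\<^sup>2) = (norm x)\<^sup>2"
    by (simp add: norm_vec_def L2_set_def sum_nonneg)
  then show ?case
    by (simp add: sum_lists_length_Suc power_mult_distrib Suc flip: sum_distrib_left sum_distrib_right)
qed

text \<open>
  Each component is an inner product of a slice of \<open>A\<close> with the tensor power of \<open>x\<close>; apply the
  Cauchy-Schwarz inequality to it and add up the squares of the slices.
\<close>

lemma norm_tensor_app_le:
  fixes x :: "real ^ 'n::finite"
  assumes "m \<ge> 1"
  shows "norm (tensor_app m A x) \<le> frob_norm m A * norm x ^ (m - 1)"
proof -
  have m: "m = Suc (m - 1)" using assms by simp
  have "(tensor_app m A x $ i)\<^sup>2
      \<le> (\<Sum>js | length js = m - 1. (A (i # js))\<^sup>2) * (norm x ^ (m - 1))\<^sup>2" for i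
    unfolding tensor_app_def vec_lambda_beta sum_monom_at_squares[symmetric]
    by (rule Cauchy_Schwarz_ineq_sum)
  then have "(\<Sum>i\<in>UNIV. (tensor_app m A x $ i)\<^sup>2)
      \<le> (\<Sum>i\<in>UNIV. (\<Sum>js | length js = m - 1. (A (i # js))\<^sup>2) * (norm x ^ (m - 1))\<^sup>2)"
    by (rule sum_mono)
  also have "\<dots> = (\<Sum>is | length is = m. (A is)\<^sup>2) * (norm x ^ (m - 1))\<^sup>2"
    by (subst (3) m) (simp only: sum_lists_length_Suc sum_distrib_right)
  also have "\<dots> = (frob_norm m A * norm x ^ (m - 1))\<^sup>2"
    by (simp add: frob_norm_def power_mult_distrib sum_nonneg)
  finally have "(norm (tensor_app m A x))\<^sup>2 \<le> (frob_norm m A * norm x ^ (m - 1))\<^sup>2"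
    by (simp add: norm_vec_def L2_set_def sum_nonneg)
  then show ?thesis
    by (rule power2_le_imp_le) (simp add: frob_norm_def sum_nonneg)
qed

lemma tensor_app_diff: "tensor_app m (A - B) x = tensor_app m A x - tensor_app m B x"
  by (simp add: tensor_app_def vec_eq_iff left_diff_distrib sum_subtractf)

section \<open>The derivative of a tensor application\<close>

fun monom_deriv :: "real ^ 'n \<Rightarrow> 'n list \<Rightarrow> real ^ 'n \<Rightarrow> real" where
  "monom_deriv x [] v = 0"
| "monom_deriv x (j # js) v = v $ j * monom_at x js + x $ j * monom_deriv x js v"

lemma has_derivative_monom_at:
  fixes x :: "real ^ 'n::finite"
  shows "((\<lambda>y. monom_at y js) has_derivative monom_deriv x js) (at x)"
proof (induction js)
  case Nil
  then show ?case by simp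
next
  case (Cons j js)
  have "((\<lambda>y. y $ j) has_derivative (\<lambda>v. v $ j)) (at x)"
    by (rule bounded_linear_imp_has_derivative[OF bounded_linear_vec_nth])
  from has_derivative_mult[OF this Cons] show ?case
    by (simp add: add.commute)
qed

lemma has_derivative_tensor_app:
  fixes x :: "real ^ 'n::finite"
  shows "(tensor_app m A has_derivative
          (\<lambda>v. \<chi> i. \<Sum>js | length js = m - 1. A (i # js) * monom_deriv x js v)) (at x)"
proof (subst has_derivative_componentwise_within, rule ballI)
  fix b :: "real ^ 'n"
  assume "b \<in> Basis"
  then obtain i where b: "b = axis i 1"
    by (auto simp: Basis_vec_def)
  show "((\<lambda>y. tensor_app m A y \<bullet> b) has_derivative
      (\<lambda>v. (\<chi> i. \<Sum>js | length js = m - 1. A (i # js) * monom_deriv x js v) \<bullet> b)) (at x)"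
    unfolding b tensor_app_def inner_axis vec_lambda_beta inner_real_def mult_1_right
    by (intro has_derivative_sum has_derivative_mult_right has_derivative_monom_at)
qed

lemma symmetric_tensor_tail:
  assumes "symmetric_tensor (Suc k) B"
  shows "symmetric_tensor k (\<lambda>js. B (j # js))"
  using assms unfolding symmetric_tensor_def by (metis length_Cons mset.simps(2))

text \<open>
  The derivative of a monomial puts \<open>v\<close> in each position of the index list in turn, and symmetry
  makes all positions contribute the same amount. In the induction it suffices to exchange the first
  two indices: where \<open>v\<close> sits in the tail, the induction hypothesis brings it to the second
  place of the list, and the exchange to the first.
\<close>

lemma sum_symmetric_monom_deriv:
  fixes x v :: "real ^ 'n::finite"
  assumes "symmetric_tensor (Suc k) B"
  shows "(\<Sum>js | length js = Suc k. B js * monom_deriv x js v)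
       = real (Suc k) * (\<Sum>j\<in>UNIV. \<Sum>ks | length ks = k. B (j # ks) * v $ j * monom_at x ks)"
  using assms
proof (induction k arbitrary: B)
  case 0
  then show ?case by (simp add: sum_lists_length_Suc)
next
  case (Suc k)
  have swap: "B (j # l # rs) = B (l # j # rs)" if "length rs = k" for j l rs
    using Suc.prems that unfolding symmetric_tensor_def by (simp add: add_mset_commute)
  have "(\<Sum>j\<in>UNIV. x $ j * (\<Sum>ks | length ks = Suc k. B (j # ks) * monom_deriv x ks v))
      = real (Suc k) * (\<Sum>j\<in>UNIV. \<Sum>l\<in>UNIV. \<Sum>rs | length rs = k.
          x $ j * (B (j # l # rs) * v $ l * monom_at x rs))"
    by (simp only: Suc.IH[OF symmetric_tensor_tail[OF Suc.prems]] sum_distrib_left mult.left_commute)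
  also have "(\<Sum>j\<in>UNIV. \<Sum>l\<in>UNIV. \<Sum>rs | length rs = k.
          x $ j * (B (j # l # rs) * v $ l * monom_at x rs))
      = (\<Sum>l\<in>UNIV. \<Sum>j\<in>UNIV. \<Sum>rs | length rs = k.
          B (l # j # rs) * v $ l * monom_at x (j # rs))"
    by (subst sum.swap) (auto intro!: sum.cong simp: swap)
  finally have IH: "(\<Sum>j\<in>UNIV. x $ j * (\<Sum>ks | length ks = Suc k. B (j # ks) * monom_deriv x ks v))
      = real (Suc k) * (\<Sum>l\<in>UNIV. \<Sum>ks | length ks = Suc k. B (l # ks) * v $ l * monom_at x ks)"
    by (simp only: sum_lists_length_Suc)
  have "(\<Sum>js | length js = Suc (Suc k). B js * monom_deriv x js v)
      = (\<Sum>j\<in>UNIV. \<Sum>ks | length ks = Suc k. B (j # ks) * v $ j * monom_at x ks)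
      + (\<Sum>j\<in>UNIV. x $ j * (\<Sum>ks | length ks = Suc k. B (j # ks) * monom_deriv x ks v))"
    by (simp only: sum_lists_length_Suc[of _ "Suc k"] monom_deriv.simps distrib_left sum.distrib
        sum_distrib_left mult.assoc mult.left_commute)
  then show ?case
    unfolding IH by (simp only: of_nat_Suc distrib_right mult_1)
qed

lemma inner_deriv_tensor_app:
  fixes x v :: "real ^ 'n::finite"
  assumes "m \<ge> 2" and "sub_symmetric m A"
  shows "v \<bullet> (\<chi> i. \<Sum>js | length js = m - 1. A (i # js) * monom_deriv x js v)
       = real (m - 1) * (\<Sum>i\<in>UNIV. \<Sum>j\<in>UNIV. \<Sum>ks | length ks = m - 2.
           A (i # j # ks) * v $ i * v $ j * monom_at x ks)"
proof -
  define k where "k = m - 2"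
  have m: "m - 1 = Suc k" "m - 2 = k" using assms(1) by (auto simp: k_def)
  have sym: "symmetric_tensor (Suc k) (\<lambda>js. A (i # js))" for i
    using assms(2) unfolding sub_symmetric_def m by blast
  show ?thesis
    unfolding m inner_vec_def vec_lambda_beta sum_symmetric_monom_deriv[OF sym]
    by (simp add: sum_distrib_left mult_ac del: of_nat_Suc)
qed

section \<open>A residual bound for complementarity problems\<close>

text \<open>
  Here \<open>w\<close> stands for the value at \<open>x\<close> of an arbitrary perturbation of \<open>F\<close> of which \<open>x\<close> is a
  solution, so that the constant does not depend on how \<open>F\<close> was perturbed.
\<close>

lemma complementarity_residual_bound:
  fixes F L :: "real ^ 'n::finite \<Rightarrow> real ^ 'n"
  assumes K: "closed K" "xbar \<in> K"
    and cont: "continuous_on UNIV F"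
    and deriv: "(F has_derivative L) (at xbar)"
    and sol: "F xbar \<in> dual_cone K" "xbar \<bullet> F xbar = 0"
    and pos: "\<And>v. v \<in> tangent_cone xbar K \<Longrightarrow> v \<bullet> F xbar = 0 \<Longrightarrow> v \<noteq> 0 \<Longrightarrow> v \<bullet> L v > 0"
    and B: "compact B"
    and uniq: "\<And>x. x \<in> K \<Longrightarrow> x \<in> B \<Longrightarrow> F x \<in> dual_cone K \<Longrightarrow> x \<bullet> F x = 0 \<Longrightarrow> x = xbar"
  shows "\<exists>c>0. \<forall>x\<in>K \<inter> B. \<forall>w\<in>dual_cone K. x \<bullet> w = 0 \<longrightarrow> norm (x - xbar) \<le> c * norm (w - F x)"
proof (rule ccontr)
  assume neg: "\<not> ?thesis"
  have "\<exists>x w. x \<in> K \<and> x \<in> B \<and> w \<in> dual_cone K \<and> x \<bullet> w = 0 \<and>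
      norm (x - xbar) > real (Suc k) * norm (w - F x)" for k
    using neg[simplified, rule_format, of "real (Suc k)"] by (force simp: not_le)
  then obtain x w where x: "\<And>k. x k \<in> K" "\<And>k. x k \<in> B" and w: "\<And>k. w k \<in> dual_cone K"
    "\<And>k. x k \<bullet> w k = 0" and far: "\<And>k. norm (x k - xbar) > real (Suc k) * norm (w k - F (x k))"
    by metis
  define t where "t k = norm (x k - xbar)" for k
  define v where "v k = (x k - xbar) /\<^sub>R t k" for k
  \<comment> \<open>Residuals relative to the distance \<open>t k\<close>; the choice of \<open>x\<close> and \<open>w\<close> makes them vanish
    in the limit.\<close>
  define e where "e k = (w k - F (x k)) /\<^sub>R t k" for k
  have t: "t k > 0" for k
    unfolding t_def by (rule le_less_trans[OF _ far]) simp
  have v: "v k \<in> sphere 0 1" for k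
    using t[of k] by (simp add: v_def) (simp add: t_def)
  have e_le: "norm (e k) \<le> inverse (real (Suc k))" for k
  proof -
    have "real (Suc k) * norm (w k - F (x k)) \<le> t k"
      using far[of k] by (simp add: t_def)
    moreover have "norm (e k) = norm (w k - F (x k)) / t k"
      using t[of k] by (simp add: e_def divide_inverse mult.commute)
    ultimately have "real (Suc k) * norm (e k) \<le> 1"
      using t[of k] by (simp add: pos_divide_le_eq del: of_nat_Suc)
    then show ?thesis
      by (simp add: inverse_eq_divide pos_le_divide_eq mult.commute del: of_nat_Suc)
  qed
  have e0: "e \<longlonglongrightarrow> 0"
    by (rule Lim_null_comparison[OF always_eventually LIMSEQ_inverse_real_of_nat]) (use e_le in blast)
  have "compact (B \<times> sphere (0 :: real ^ 'n) 1)"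
    using B by (intro compact_Times) auto
  then obtain z r where z: "z \<in> B \<times> sphere 0 1" and r: "strict_mono (r :: nat \<Rightarrow> nat)"
    and lim: "((\<lambda>k. (x k, v k)) \<circ> r) \<longlonglongrightarrow> z"
    unfolding compact_def using x(2) v by (metis (no_types, lifting) mem_Sigma_iff)
  define xs vs where "xs = fst z" and "vs = snd z"
  have xs_B: "xs \<in> B" and vs: "norm vs = 1"
    using z by (auto simp: xs_def vs_def)
  have xr: "(\<lambda>k. x (r k)) \<longlonglongrightarrow> xs" and vr: "(\<lambda>k. v (r k)) \<longlonglongrightarrow> vs"
    using tendsto_fst[OF lim] tendsto_snd[OF lim] by (simp_all add: o_def xs_def vs_def)
  have er: "(\<lambda>k. e (r k)) \<longlonglongrightarrow> 0"
    using LIMSEQ_subseq_LIMSEQ[OF e0 r] by (simp add: o_def)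
  have Fr: "(\<lambda>k. F (x (r k))) \<longlonglongrightarrow> F xs"
    using cont xr by (auto simp: continuous_on_eq_continuous_at intro: isCont_tendsto_compose)
  have w_eq: "w k = F (x k) + t k *\<^sub>R e k" for k
    using t[of k] by (simp add: e_def)
  have x_eq: "x k - xbar = t k *\<^sub>R v k" for k
    using t[of k] by (simp add: v_def)
  have tr: "(\<lambda>k. t (r k)) \<longlonglongrightarrow> norm (xs - xbar)"
    unfolding t_def by (intro tendsto_intros xr)
  have wr: "(\<lambda>k. w (r k)) \<longlonglongrightarrow> F xs"
    using tendsto_add[OF Fr tendsto_scaleR[OF tr er]] by (simp add: w_eq)

  \<comment> \<open>The residuals tend to 0, so the limit point solves the unperturbed problem.\<close>
  have "xs \<in> K"
    using closed_sequentially[OF K(1) _ xr] x(1) by blast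
  moreover have "F xs \<in> dual_cone K"
    unfolding dual_cone_def
  proof (clarify)
    fix y assume "y \<in> K"
    then have "w (r k) \<bullet> y \<ge> 0" for k using w(1)[of "r k"] by (auto simp: dual_cone_def)
    then show "F xs \<bullet> y \<ge> 0"
      by (intro tendsto_lowerbound[OF tendsto_inner[OF wr tendsto_const]]) auto
  qed
  moreover have "xs \<bullet> F xs = 0"
    using tendsto_inner[OF xr wr] w(2) by (simp add: LIMSEQ_const_iff)
  ultimately have xs: "xs = xbar" using uniq xs_B by blast

  have tr0: "(\<lambda>k. t (r k)) \<longlonglongrightarrow> 0" using tr xs by simp
  have tan: "vs \<in> tangent_cone xbar K"
    unfolding tangent_cone_def mem_Collect_eq
    using x(1) t xr xs tr0 vr
    by (intro exI[of _ "\<lambda>k. x (r k)"] exI[of _ "\<lambda>k. t (r k)"]) (simp add: v_def)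

  \<comment> \<open>The opposite signs of these two products make \<open>vs\<close> critical, and their difference bounds
    the slope of \<open>F\<close> along \<open>v k\<close>.\<close>
  have lower: "v k \<bullet> F xbar \<ge> 0" for k
  proof -
    have "F xbar \<bullet> x k \<ge> 0" using sol(1) x(1) by (auto simp: dual_cone_def)
    then have "(x k - xbar) \<bullet> F xbar \<ge> 0"
      using sol(2) by (simp add: inner_diff_left inner_commute[of "x k"])
    then show ?thesis using t[of k] by (simp add: x_eq zero_le_mult_iff)
  qed
  have upper: "v k \<bullet> w k \<le> 0" for k
  proof -
    have "w k \<bullet> xbar \<ge> 0" using w(1)[of k] K(2) by (auto simp: dual_cone_def)
    then have "(x k - xbar) \<bullet> w k \<le> 0"
      using w(2)[of k] by (simp add: inner_diff_left inner_commute[of xbar])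
    then show ?thesis using t[of k] by (simp add: x_eq mult_le_0_iff)
  qed
  have "vs \<bullet> F xbar \<ge> 0"
    by (rule tendsto_lowerbound[OF tendsto_inner[OF vr tendsto_const]]) (use lower in auto)
  moreover have "vs \<bullet> F xbar \<le> 0"
    using tendsto_upperbound[OF tendsto_inner[OF vr wr], of 0] upper xs by auto
  ultimately have crit: "vs \<bullet> F xbar = 0" by simp

  \<comment> \<open>The normalised remainder of the first-order expansion of \<open>F\<close> at \<open>xbar\<close>.\<close>
  define rem where "rem k = (F (x k) - F xbar - L (x k - xbar)) /\<^sub>R t k" for k
  have lin: "bounded_linear L" using deriv by (rule has_derivative_bounded_linear)
  have at: "filterlim (\<lambda>k. x (r k)) (at xbar) sequentially"
    unfolding filterlim_at using xr xs t by (auto simp: t_def)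
  have "((\<lambda>y. norm (F y - F xbar - L (y - xbar)) / norm (y - xbar)) \<longlongrightarrow> 0) (at xbar)"
    using deriv by (simp add: has_derivative_iff_norm)
  from filterlim_compose[OF this at] have "(\<lambda>k. norm (rem (r k))) \<longlonglongrightarrow> 0"
    using t by (simp add: rem_def t_def divide_inverse mult.commute)
  then have remr: "(\<lambda>k. rem (r k)) \<longlonglongrightarrow> 0" by (rule tendsto_norm_zero_cancel)
  have slope: "v k \<bullet> (rem k + L (v k) + e k) \<le> 0" for k
  proof -
    have "w k - F xbar = t k *\<^sub>R (rem k + L (v k) + e k)"
      using t[of k] by (simp add: w_eq rem_def x_eq scaleR_right_distrib
          bounded_linear.linear[OF lin, THEN linear_scale])
    moreover have "v k \<bullet> (w k - F xbar) \<le> 0"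
      using lower[of k] upper[of k] by (simp add: inner_diff_right)
    ultimately show ?thesis using t[of k] by (simp add: mult_le_0_iff)
  qed
  have "(\<lambda>k. v (r k) \<bullet> (rem (r k) + L (v (r k)) + e (r k))) \<longlonglongrightarrow> vs \<bullet> (0 + L vs + 0)"
    by (intro tendsto_intros vr remr er bounded_linear.tendsto[OF lin])
  then have "vs \<bullet> L vs \<le> 0"
    using slope by (intro tendsto_upperbound[where a = 0 and F = sequentially]) auto
  moreover have "vs \<noteq> 0" using vs by auto
  ultimately show False using pos[OF tan crit] by simp
qed

section \<open>Stability of the solution of a tensor complementarity problem\<close>

theorem theorem5p2:
  fixes m :: nat
    and K :: "(real ^ ('n::finite)) set"
    and qbar xbar :: "real ^ 'n"
    and Abar :: "'n tensor"
    and N :: "(real ^ 'n) set"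
  assumes "m \<ge> 2"
    and "K \<in> cones"
    and "Abar \<in> tensors m"
    and "xbar \<in> SOL m K qbar Abar"
    and "sub_symmetric m Abar"
    and "\<And>v. v \<in> tangent_cone xbar K \<inter> critical_hyperplane m qbar Abar xbar \<Longrightarrow> v \<noteq> 0 \<Longrightarrow>
           (\<Sum>i\<in>UNIV. \<Sum>j\<in>UNIV. \<Sum>ks | length ks = m - 2.
              Abar (i # j # ks) * v $ i * v $ j * monom_at xbar ks) > 0"
    and "open N" and "xbar \<in> N" and "bounded N"
    and "SOL m K qbar Abar \<inter> closure N = {xbar}"
  shows "\<exists>c>0. \<forall>q. \<forall>A\<in>tensors m.
           (SUP x \<in> SOL m K q A \<inter> closure N. ereal (norm (x - xbar)))
             \<le> ereal (c * (norm (q - qbar) + frob_norm m (A - Abar)))"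
proof -
  define F where "F x = tensor_app m Abar x + qbar" for x
  define L where "L v = (\<chi> i. \<Sum>js | length js = m - 1. Abar (i # js) * monom_deriv xbar js v)" for v
  have deriv: "(F has_derivative L) (at xbar)"
    unfolding F_def L_def
    by (rule has_derivative_eq_rhs[OF has_derivative_add[OF has_derivative_tensor_app has_derivative_const]]) simp
  have cont: "continuous_on UNIV F"
    unfolding F_def
    by (intro continuous_intros has_derivative_continuous_on[OF has_derivative_at_withinI[OF has_derivative_tensor_app]])
  have pos: "v \<bullet> L v > 0" if "v \<in> tangent_cone xbar K" "v \<bullet> F xbar = 0" "v \<noteq> 0" for v
    unfolding L_def inner_deriv_tensor_app[OF assms(1,5)]
    using assms(1) assms(6)[of v] that by (auto simp: critical_hyperplane_def F_def)
  have solbar: "xbar \<in> K" "F xbar \<in> dual_cone K" "xbar \<bullet> F xbar = 0"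
    using assms(4) by (auto simp: SOL_def F_def)
  have uniq: "x = xbar" if "x \<in> K" "x \<in> closure N" "F x \<in> dual_cone K" "x \<bullet> F x = 0" for x
    using assms(10) that by (auto simp: SOL_def F_def)
  have "closed K" using assms(2) by (simp add: cones_def)
  moreover have "compact (closure N)" using assms(9) by (simp add: compact_closure)
  ultimately have "\<exists>c>0. \<forall>x\<in>K \<inter> closure N. \<forall>w\<in>dual_cone K.
      x \<bullet> w = 0 \<longrightarrow> norm (x - xbar) \<le> c * norm (w - F x)"
    by (intro complementarity_residual_bound[OF _ solbar(1) cont deriv solbar(2,3)] pos uniq)
  then obtain c where c: "c > 0" and bound: "\<And>x w. x \<in> K \<Longrightarrow> x \<in> closure N \<Longrightarrow>
      w \<in> dual_cone K \<Longrightarrow> x \<bullet> w = 0 \<Longrightarrow> norm (x - xbar) \<le> c * norm (w - F x)"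
    by (auto simp: Ball_def)
  obtain R where R: "\<And>x. x \<in> closure N \<Longrightarrow> norm x \<le> R"
    using bounded_closure[OF assms(9)] by (auto simp: bounded_iff)
  \<comment> \<open>The maximum with 1 lets one constant serve both the perturbation of \<open>qbar\<close>, which enters with
    factor 1, and that of \<open>Abar\<close>, which enters with factor at most \<open>R ^ (m - 1)\<close>.\<close>
  define M where "M = max 1 (R ^ (m - 1))"
  have M: "M \<ge> 1" "R ^ (m - 1) \<le> M" by (auto simp: M_def)
  have "norm (x - xbar) \<le> c * M * (norm (q - qbar) + frob_norm m (A - Abar))"
    if x: "x \<in> SOL m K q A" "x \<in> closure N" for q A x
  proof -
    have frob: "frob_norm m (A - Abar) \<ge> 0" by (simp add: frob_norm_def sum_nonneg)
    have "norm (x - xbar) \<le> c * norm (tensor_app m A x + q - F x)"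
      using x by (intro bound) (auto simp: SOL_def)
    also have "tensor_app m A x + q - F x = (q - qbar) + tensor_app m (A - Abar) x"
      by (simp add: F_def tensor_app_diff)
    also have "norm \<dots> \<le> norm (q - qbar) + norm (tensor_app m (A - Abar) x)"
      by (rule norm_triangle_ineq)
    also have "norm (tensor_app m (A - Abar) x) \<le> frob_norm m (A - Abar) * norm x ^ (m - 1)"
      using assms(1) by (intro norm_tensor_app_le) simp
    finally have "norm (x - xbar)
        \<le> c * (norm (q - qbar) + frob_norm m (A - Abar) * norm x ^ (m - 1))"
      using c by simp
    also have "\<dots> \<le> c * (M * norm (q - qbar) + M * frob_norm m (A - Abar))"
    proof (intro mult_left_mono add_mono)
      show "norm (q - qbar) \<le> M * norm (q - qbar)"
        using mult_right_mono[OF M(1) norm_ge_zero[of "q - qbar"]] by simp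
      have "norm x ^ (m - 1) \<le> M"
        using power_mono[OF R[OF x(2)] norm_ge_zero, of "m - 1"] M(2) by linarith
      then show "frob_norm m (A - Abar) * norm x ^ (m - 1) \<le> M * frob_norm m (A - Abar)"
        using mult_right_mono[OF _ frob] by (simp only: mult.commute[of "frob_norm m (A - Abar)"])
    qed (use c in simp)
    finally show ?thesis by (simp only: distrib_left mult.assoc)
  qed
  moreover have "c * M > 0" using c M by simp
  ultimately show ?thesis
    by (intro exI[of _ "c * M"]) (auto intro!: SUP_least)
qed

end
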